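(* Let $(S,\cdot,\leq)$ be a regular ordered semigroup. The following conditions are equivalent: (1) $S$ is inverse and completely regular; (2) $S$ is a complete semilattice of group-like ordered semigroups; (3) for all $a,b\in S$, if $ab\in E_\leq(S)$ and $ba\in E_\leq(S)$ then $ab\,\mathcal{H}\,ba$; (4) every ordered idempotent of $S$ is $\mathcal{H}$-commutative with every element of $S$; (5) for all $e,f\in E_\leq(S)$, $e\,\mathcal{J}\,f$ implies $e\,\mathcal{H}\,f$; (6) $\mathcal{H}=\mathcal{L}=\mathcal{R}=\mathcal{J}$ on $S$.
   Context: An ordered semigroup $(S,\cdot,\leq)$ is a semigroup with a partial order such that $a\leq b$ implies $xa\leq xb$ and $ax\leq bx$ for all $a,b,x\in S$. For $H\subseteq S$, $(H]=\{t\in S: t\leq h \text{ for some } h\in H\}$. $S$ is regular if $a\in(aSa]$ for every $a\in S$, and completely regular if $a\in(a^2Sa^2]$ for every $a\in S$. The principal left, right and two-sided ideals generated by $a\in S$ are $L(a)=(S^1a]$, $R(a)=(aS^1]$ and $I(a)=(S^1aS^1]$, where $S^1$ is $S$ with an identity adjoined (so $S^1a=\{a\}\cup Sa$, $aS^1=\{a\}\cup aS$, $S^1aS^1=\{a\}\cup Sa\cup aS\cup SaS$). Green's relations: $a\,\mathcal{L}\,b$ iff $L(a)=L(b)$; $a\,\mathcal{R}\,b$ iff $R(a)=R(b)$; $a\,\mathcal{J}\,b$ iff $I(a)=I(b)$; $\mathcal{H}=\mathcal{L}\cap\mathcal{R}$. An ordered idempotent is an element $e\in S$ with $e\leq e^2$;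 $E_\leq(S)$ is the set of ordered idempotents of $S$. An element $b\in S$ is an inverse of $a\in S$ if $a\leq aba$ and $b\leq bab$; $V_\leq(a)$ is the set of inverses of $a$. A regular ordered semigroup $S$ is called inverse if for every $a\in S$ any two elements of $V_\leq(a)$ are $\mathcal{H}$-related. Elements $a,b\in S$ are $\mathcal{H}$-commutative if $ab\leq bxa$ for some $x\in S$. A regular ordered semigroup $T$ is group-like if for all $a,b\in T$, $a\in(Tb]$ and $b\in(aT]$ (downward closures taken in $T$). A semilattice congruence on $S$ is a congruence $\rho$ (an equivalence relation compatible with left and right multiplication) such that $a\,\rho\,a^2$ and $ab\,\rho\,ba$ for all $a,b\in S$; it is a complete semilattice congruence if in addition $a\leq b$ implies $a\,\rho\,ab$. $S$ is a complete semilattice of group-like ordered semigroups if there is a complete semilattice congruence $\rho$ on $S$ such that every $\rho$-class, with the induced operation and order, is a group-like ordered semigroup. *)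

theory Defs
  imports "HOL-Algebra.Congruence"
begin

section \<open>Ordered semigroups\<close>

text \<open>A substructure carried by \<open>T\<close>, with the induced operation and order, is
  \<open>S\<lparr>carrier := T\<rparr>\<close>. In each definition below, elements, multipliers and downward closures
  range over the carrier of the structure at hand.\<close>

record 'a osgrp = "'a partial_object" +
  os_mult :: "'a \<Rightarrow> 'a \<Rightarrow> 'a" (infixl "\<cdot>\<index>" 70)
  os_le :: "'a \<Rightarrow> 'a \<Rightarrow> bool" (infix "\<preceq>\<index>" 50)

locale ordered_semigroup =
  fixes S :: "('a, 'm) osgrp_scheme" (structure)
  assumes mult_closed: "a \<in> carrier S \<Longrightarrow> b \<in> carrier S \<Longrightarrow> a \<cdot> b \<in> carrier S"
    and mult_assoc: "a \<in> carrier S \<Longrightarrow> b \<in> carrier S \<Longrightarrow> c \<in> carrier S \<Longrightarrow> a \<cdot> b \<cdot> c = a \<cdot> (b \<cdot> c)"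
    and le_refl: "reflp_on (carrier S) (\<preceq>)"
    and le_trans: "transp_on (carrier S) (\<preceq>)"
    and le_antisym: "antisymp_on (carrier S) (\<preceq>)"
    and mult_left_mono: "a \<in> carrier S \<Longrightarrow> b \<in> carrier S \<Longrightarrow> x \<in> carrier S \<Longrightarrow> a \<preceq> b \<Longrightarrow> x \<cdot> a \<preceq> x \<cdot> b"
    and mult_right_mono: "a \<in> carrier S \<Longrightarrow> b \<in> carrier S \<Longrightarrow> x \<in> carrier S \<Longrightarrow> a \<preceq> b \<Longrightarrow> a \<cdot> x \<preceq> b \<cdot> x"

definition down :: "('a, 'm) osgrp_scheme \<Rightarrow> 'a set \<Rightarrow> 'a set" where
  "down S H = {t \<in> carrier S. \<exists>h\<in>H. t \<preceq>\<^bsub>S\<^esub> h}"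

locale regular_ordered_semigroup = ordered_semigroup +
  assumes regular: "a \<in> carrier S \<Longrightarrow> a \<in> down S {a \<cdot> s \<cdot> a |s. s \<in> carrier S}"

locale completely_regular_ordered_semigroup = ordered_semigroup +
  assumes completely_regular:
    "a \<in> carrier S \<Longrightarrow> a \<in> down S {(a \<cdot> a) \<cdot> s \<cdot> (a \<cdot> a) |s. s \<in> carrier S}"

section \<open>Principal ideals and Green's relations\<close>

definition left_ideal :: "('a, 'm) osgrp_scheme \<Rightarrow> 'a \<Rightarrow> 'a set" where
  "left_ideal S a = down S ({a} \<union> {s \<cdot>\<^bsub>S\<^esub> a |s. s \<in> carrier S})"

definition right_ideal :: "('a, 'm) osgrp_scheme \<Rightarrow> 'a \<Rightarrow> 'a set" where
  "right_ideal S a = down S ({a} \<union> {a \<cdot>\<^bsub>S\<^esub> s |s. s \<in> carrier S})"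

definition two_sided_ideal :: "('a, 'm) osgrp_scheme \<Rightarrow> 'a \<Rightarrow> 'a set" where
  "two_sided_ideal S a = down S ({a} \<union> {s \<cdot>\<^bsub>S\<^esub> a |s. s \<in> carrier S}
     \<union> {a \<cdot>\<^bsub>S\<^esub> s |s. s \<in> carrier S}
     \<union> {s \<cdot>\<^bsub>S\<^esub> a \<cdot>\<^bsub>S\<^esub> t |s t. s \<in> carrier S \<and> t \<in> carrier S})"

definition green_L :: "('a, 'm) osgrp_scheme \<Rightarrow> ('a \<times> 'a) set" where
  "green_L S = {(a, b). a \<in> carrier S \<and> b \<in> carrier S \<and> left_ideal S a = left_ideal S b}"

definition green_R :: "('a, 'm) osgrp_scheme \<Rightarrow> ('a \<times> 'a) set" where
  "green_R S = {(a, b). a \<in> carrier S \<and> b \<in> carrier S \<and> right_ideal S a = right_ideal S b}"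

definition green_J :: "('a, 'm) osgrp_scheme \<Rightarrow> ('a \<times> 'a) set" where
  "green_J S = {(a, b). a \<in> carrier S \<and> b \<in> carrier S \<and> two_sided_ideal S a = two_sided_ideal S b}"

definition green_H :: "('a, 'm) osgrp_scheme \<Rightarrow> ('a \<times> 'a) set" where
  "green_H S = green_L S \<inter> green_R S"

section \<open>Ordered idempotents, inverses, commutation\<close>

definition ordered_idempotents :: "('a, 'm) osgrp_scheme \<Rightarrow> 'a set" where
  "ordered_idempotents S = {e \<in> carrier S. e \<preceq>\<^bsub>S\<^esub> e \<cdot>\<^bsub>S\<^esub> e}"

definition inverses :: "('a, 'm) osgrp_scheme \<Rightarrow> 'a \<Rightarrow> 'a set" where
  "inverses S a = {b \<in> carrier S. a \<preceq>\<^bsub>S\<^esub> a \<cdot>\<^bsub>S\<^esub> b \<cdot>\<^bsub>S\<^esub> a \<and> b \<preceq>\<^bsub>S\<^esub> b \<cdot>\<^bsub>S\<^esub> a \<cdot>\<^bsub>S\<^esub> b}"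

locale inverse_ordered_semigroup = regular_ordered_semigroup +
  assumes inverses_green_H:
    "a \<in> carrier S \<Longrightarrow> b \<in> inverses S a \<Longrightarrow> c \<in> inverses S a \<Longrightarrow> (b, c) \<in> green_H S"

text \<open>The condition is not symmetric in \<open>a\<close> and \<open>b\<close>.\<close>

definition H_commutative :: "('a, 'm) osgrp_scheme \<Rightarrow> 'a \<Rightarrow> 'a \<Rightarrow> bool" where
  "H_commutative S a b \<longleftrightarrow> (\<exists>x\<in>carrier S. a \<cdot>\<^bsub>S\<^esub> b \<preceq>\<^bsub>S\<^esub> b \<cdot>\<^bsub>S\<^esub> x \<cdot>\<^bsub>S\<^esub> a)"

section \<open>Complete semilattices of group-like ordered semigroups\<close>

locale group_like_ordered_semigroup = regular_ordered_semigroup +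
  assumes left_group_like:
    "a \<in> carrier S \<Longrightarrow> b \<in> carrier S \<Longrightarrow> a \<in> down S {s \<cdot> b |s. s \<in> carrier S}"
  and right_group_like:
    "a \<in> carrier S \<Longrightarrow> b \<in> carrier S \<Longrightarrow> b \<in> down S {a \<cdot> s |s. s \<in> carrier S}"

definition os_congruence :: "('a, 'm) osgrp_scheme \<Rightarrow> ('a \<times> 'a) set \<Rightarrow> bool" where
  "os_congruence S \<rho> \<longleftrightarrow> equiv (carrier S) \<rho> \<and>
     (\<forall>(a, b)\<in>\<rho>. \<forall>c\<in>carrier S. (c \<cdot>\<^bsub>S\<^esub> a, c \<cdot>\<^bsub>S\<^esub> b) \<in> \<rho> \<and> (a \<cdot>\<^bsub>S\<^esub> c, b \<cdot>\<^bsub>S\<^esub> c) \<in> \<rho>)"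

definition semilattice_congruence :: "('a, 'm) osgrp_scheme \<Rightarrow> ('a \<times> 'a) set \<Rightarrow> bool" where
  "semilattice_congruence S \<rho> \<longleftrightarrow> os_congruence S \<rho> \<and>
     (\<forall>a\<in>carrier S. (a, a \<cdot>\<^bsub>S\<^esub> a) \<in> \<rho>) \<and>
     (\<forall>a\<in>carrier S. \<forall>b\<in>carrier S. (a \<cdot>\<^bsub>S\<^esub> b, b \<cdot>\<^bsub>S\<^esub> a) \<in> \<rho>)"

definition complete_semilattice_congruence :: "('a, 'm) osgrp_scheme \<Rightarrow> ('a \<times> 'a) set \<Rightarrow> bool" where
  "complete_semilattice_congruence S \<rho> \<longleftrightarrow> semilattice_congruence S \<rho> \<and>
     (\<forall>a\<in>carrier S. \<forall>b\<in>carrier S. a \<preceq>\<^bsub>S\<^esub> b \<longrightarrow> (a, a \<cdot>\<^bsub>S\<^esub> b) \<in> \<rho>)"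

definition complete_semilattice_of_group_likes :: "('a, 'm) osgrp_scheme \<Rightarrow> bool" where
  "complete_semilattice_of_group_likes S \<longleftrightarrow>
     (\<exists>\<rho>. complete_semilattice_congruence S \<rho> \<and>
       (\<forall>T\<in>carrier S // \<rho>. group_like_ordered_semigroup (S\<lparr>carrier := T\<rparr>)))"

end

theory Submission
  imports Defs
begin

text \<open>In a regular ordered semigroup the principal ideals are \<open>L(a) = (Sa]\<close>, \<open>R(a) = (aS]\<close>,
  \<open>I(a) = (SaS]\<close>, so Green's relations are the symmetric parts of three divisibility preorders.
  If \<open>c\<close> is an inverse of \<open>ea\<close>, then \<open>eac\<close>, \<open>ace\<close> and \<open>cea\<close> are ordered idempotents obtained
  from each other by rotation, so (3) gives (4). Condition (4) makes every one-sided principal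
  ideal two-sided, so that all three preorders coincide; this yields (1), (2) and (6), with
  \<open>\<J>\<close> as the semilattice congruence in (2). Conversely, (6) gives (5), and (5) gives (3) because
  \<open>ab \<le> a(ba)b\<close>; (2) gives (3) because \<open>ab\<close> and \<open>ba\<close> lie in one class. Finally, under (1) every
  element is \<open>\<H>\<close>-related to an ordered idempotent, and \<open>\<L>\<close>- or \<open>\<R>\<close>-related ordered idempotents
  are \<open>\<H>\<close>-related; applied to \<open>aba\<close>, which is \<open>\<R>\<close>-related to \<open>ab\<close> and \<open>\<L>\<close>-related to \<open>ba\<close>,
  this gives (3).\<close>

section \<open>The order on the carrier and the three divisibility preorders\<close>

context ordered_semigroup
begin

declare mult_closed [simp, intro]

text \<open>The order restricted to the carrier, so that transitivity has no side conditions.\<close>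

definition below :: "'a \<Rightarrow> 'a \<Rightarrow> bool" (infix "\<sqsubseteq>" 50)
  where "a \<sqsubseteq> b \<longleftrightarrow> a \<in> carrier S \<and> b \<in> carrier S \<and> a \<preceq> b"

lemma below_carrier: "a \<sqsubseteq> b \<Longrightarrow> a \<in> carrier S" "a \<sqsubseteq> b \<Longrightarrow> b \<in> carrier S"
  by (auto simp: below_def)

lemma below_refl [simp, intro]: "a \<in> carrier S \<Longrightarrow> a \<sqsubseteq> a"
  using le_refl by (auto simp: below_def reflp_on_def)

lemma below_trans [trans]: "a \<sqsubseteq> b \<Longrightarrow> b \<sqsubseteq> c \<Longrightarrow> a \<sqsubseteq> c"
  using le_trans unfolding below_def transp_on_def by blast

lemma below_mult: "a \<sqsubseteq> b \<Longrightarrow> c \<sqsubseteq> d \<Longrightarrow> a \<cdot> c \<sqsubseteq> b \<cdot> d"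
  by (rule below_trans [of _ "b \<cdot> c"]) (auto simp: below_def intro: mult_left_mono mult_right_mono)

text \<open>Membership of \<open>a\<close> in \<open>(Sb]\<close>, with no identity adjoined:
  transitivity holds in every ordered semigroup, but reflexivity has to come from regularity.
  \<open>rle\<close> and \<open>jle\<close> are the analogues for \<open>(bS]\<close> and
  \<open>(SbS]\<close>.\<close>

definition lle :: "'a \<Rightarrow> 'a \<Rightarrow> bool"
  where "lle a b \<longleftrightarrow> a \<in> carrier S \<and> b \<in> carrier S \<and> (\<exists>x\<in>carrier S. a \<sqsubseteq> x \<cdot> b)"

definition rle :: "'a \<Rightarrow> 'a \<Rightarrow> bool"
  where "rle a b \<longleftrightarrow> a \<in> carrier S \<and> b \<in> carrier S \<and> (\<exists>x\<in>carrier S. a \<sqsubseteq> b \<cdot> x)"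

definition jle :: "'a \<Rightarrow> 'a \<Rightarrow> bool"
  where "jle a b \<longleftrightarrow> a \<in> carrier S \<and> b \<in> carrier S \<and>
    (\<exists>x\<in>carrier S. \<exists>y\<in>carrier S. a \<sqsubseteq> x \<cdot> b \<cdot> y)"

lemma lleI: "a \<sqsubseteq> x \<cdot> b \<Longrightarrow> x \<in> carrier S \<Longrightarrow> b \<in> carrier S \<Longrightarrow> lle a b"
  by (auto simp: lle_def below_def)

lemma rleI: "a \<sqsubseteq> b \<cdot> x \<Longrightarrow> x \<in> carrier S \<Longrightarrow> b \<in> carrier S \<Longrightarrow> rle a b"
  by (auto simp: rle_def below_def)

lemma jleI: "a \<sqsubseteq> x \<cdot> b \<cdot> y \<Longrightarrow> x \<in> carrier S \<Longrightarrow> y \<in> carrier S \<Longrightarrow> b \<in> carrier S \<Longrightarrow> jle a b"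
  by (auto simp: jle_def below_def)

lemma lle_trans [trans]:
  assumes "lle a b" "lle b c" shows "lle a c"
proof -
  obtain x y where xy: "x \<in> carrier S" "y \<in> carrier S" "a \<sqsubseteq> x \<cdot> b" "b \<sqsubseteq> y \<cdot> c"
    and "c \<in> carrier S"
    using assms by (auto simp: lle_def)
  note this(3)
  also have "x \<cdot> b \<sqsubseteq> (x \<cdot> y) \<cdot> c"
    using below_mult [OF below_refl [OF xy(1)] xy(4)] xy \<open>c \<in> carrier S\<close> by (simp add: mult_assoc)
  finally show ?thesis using xy \<open>c \<in> carrier S\<close> by (auto intro: lleI)
qed

lemma rle_trans [trans]:
  assumes "rle a b" "rle b c" shows "rle a c"
proof -
  obtain x y where xy: "x \<in> carrier S" "y \<in> carrier S" "a \<sqsubseteq> b \<cdot> x" "b \<sqsubseteq> c \<cdot> y"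
    and "c \<in> carrier S"
    using assms by (auto simp: rle_def)
  note this(3)
  also have "b \<cdot> x \<sqsubseteq> c \<cdot> (y \<cdot> x)"
    using below_mult [OF xy(4) below_refl [OF xy(1)]] xy \<open>c \<in> carrier S\<close> by (simp add: mult_assoc)
  finally show ?thesis using xy \<open>c \<in> carrier S\<close> by (auto intro: rleI)
qed

lemma jle_trans [trans]:
  assumes "jle a b" "jle b c" shows "jle a c"
proof -
  obtain x y u v where C: "x \<in> carrier S" "y \<in> carrier S" "u \<in> carrier S" "v \<in> carrier S"
      "c \<in> carrier S"
    and le: "a \<sqsubseteq> x \<cdot> b \<cdot> y" "b \<sqsubseteq> u \<cdot> c \<cdot> v"
    using assms by (auto simp: jle_def)
  note le(1)
  also have "x \<cdot> b \<cdot> y \<sqsubseteq> x \<cdot> (u \<cdot> c \<cdot> v) \<cdot> y"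
    using C le by (intro below_mult) auto
  also have "\<dots> = (x \<cdot> u) \<cdot> c \<cdot> (v \<cdot> y)" using C by (simp add: mult_assoc)
  finally show ?thesis using C by (auto intro: jleI)
qed

text \<open>A factor added on the right does not meet the multiplier on the left. Together with
  \<open>rle_mult_left\<close> this gives compatibility on both sides once the preorders
  coincide.\<close>

lemma lle_mult_right:
  assumes "lle a b" and c: "c \<in> carrier S" shows "lle (a \<cdot> c) (b \<cdot> c)"
proof -
  obtain x where "x \<in> carrier S" "a \<sqsubseteq> x \<cdot> b" "b \<in> carrier S"
    using assms(1) by (auto simp: lle_def)
  then show ?thesis
    using below_mult [OF \<open>a \<sqsubseteq> x \<cdot> b\<close> below_refl [OF c]] c
    by (intro lleI [of _ x]) (auto simp: mult_assoc)
qed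

lemma rle_mult_left:
  assumes "rle a b" and c: "c \<in> carrier S" shows "rle (c \<cdot> a) (c \<cdot> b)"
proof -
  obtain x where "x \<in> carrier S" "a \<sqsubseteq> b \<cdot> x" "b \<in> carrier S"
    using assms(1) by (auto simp: rle_def)
  then show ?thesis
    using below_mult [OF below_refl [OF c] \<open>a \<sqsubseteq> b \<cdot> x\<close>] c
    by (intro rleI [of _ _ x]) (auto simp: mult_assoc)
qed

lemma ordered_idempotents_iff: "e \<in> ordered_idempotents S \<longleftrightarrow> e \<sqsubseteq> e \<cdot> e"
  by (auto simp: ordered_idempotents_def below_def)

lemma inverses_iff: "a \<in> carrier S \<Longrightarrow>
    b \<in> inverses S a \<longleftrightarrow> a \<sqsubseteq> a \<cdot> b \<cdot> a \<and> b \<sqsubseteq> b \<cdot> a \<cdot> b"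
  by (auto simp: inverses_def below_def)

lemma H_commutative_iff: "a \<in> carrier S \<Longrightarrow> b \<in> carrier S \<Longrightarrow>
    H_commutative S a b \<longleftrightarrow> (\<exists>x\<in>carrier S. a \<cdot> b \<sqsubseteq> b \<cdot> x \<cdot> a)"
  by (auto simp: H_commutative_def below_def)

text \<open>Multiply \<open>a \<le> aba\<close> by \<open>b\<close> on the right and on the
  left.\<close>

lemma idempotent_mult_inverse:
  assumes C: "a \<in> carrier S" "b \<in> carrier S" and le: "a \<sqsubseteq> a \<cdot> b \<cdot> a"
  shows "a \<cdot> b \<sqsubseteq> a \<cdot> b \<cdot> (a \<cdot> b)" "b \<cdot> a \<sqsubseteq> b \<cdot> a \<cdot> (b \<cdot> a)"
  using below_mult [OF le below_refl [OF C(2)]] below_mult [OF below_refl [OF C(2)] le] C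
  by (simp_all add: mult_assoc)

end

section \<open>Inverses and Green's relations in a regular ordered semigroup\<close>

context regular_ordered_semigroup
begin

text \<open>If \<open>a \<le> asa\<close>, then \<open>sas\<close> is an inverse: putting the
  inequality into itself gives \<open>a \<le> asasa\<close>, and enclosing this between two factors
  \<open>s\<close> gives the second condition.\<close>

lemma ex_inverse:
  assumes a: "a \<in> carrier S"
  obtains b where "b \<in> carrier S" "a \<sqsubseteq> a \<cdot> b \<cdot> a" "b \<sqsubseteq> b \<cdot> a \<cdot> b"
proof -
  obtain s where s: "s \<in> carrier S" "a \<sqsubseteq> a \<cdot> s \<cdot> a"
    using regular [OF a] a by (auto simp: down_def below_def)
  have "a \<sqsubseteq> a \<cdot> s \<cdot> (a \<cdot> s \<cdot> a)"
    using below_trans [OF s(2) below_mult [OF below_refl s(2)]] a s by auto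
  moreover have "s \<cdot> a \<cdot> s \<sqsubseteq> s \<cdot> (a \<cdot> s \<cdot> (a \<cdot> s \<cdot> a)) \<cdot> s"
    using calculation a s by (intro below_mult) auto
  ultimately show ?thesis
    using that [of "s \<cdot> a \<cdot> s"] a s by (simp add: mult_assoc)
qed

text \<open>Regularity replaces the missing identity: \<open>b \<le> (bc)b\<close>. The case
  \<open>a = b\<close> is reflexivity of \<open>lle\<close>.\<close>

lemma below_imp_lle: assumes "a \<sqsubseteq> b" shows "lle a b"
proof -
  obtain c where "c \<in> carrier S" "b \<sqsubseteq> b \<cdot> c \<cdot> b"
    using ex_inverse below_carrier [OF assms] by blast
  then show ?thesis
    using assms below_carrier [OF assms] by (intro lleI [of _ "b \<cdot> c"]) (auto intro: below_trans)
qed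

lemma below_imp_rle: assumes "a \<sqsubseteq> b" shows "rle a b"
proof -
  obtain c where "c \<in> carrier S" "b \<sqsubseteq> b \<cdot> c \<cdot> b"
    using ex_inverse below_carrier [OF assms] by blast
  then show ?thesis
    using assms below_carrier [OF assms]
    by (intro rleI [of _ _ "c \<cdot> b"]) (auto intro: below_trans simp: mult_assoc)
qed

lemma lle_imp_jle: assumes "lle a b" shows "jle a b"
proof -
  obtain x where x: "x \<in> carrier S" "a \<sqsubseteq> x \<cdot> b" and b: "b \<in> carrier S"
    using assms by (auto simp: lle_def)
  obtain y where y: "y \<in> carrier S" "b \<sqsubseteq> b \<cdot> y"
    using below_imp_rle [of b b] b by (auto simp: rle_def)
  show ?thesis
    using below_trans [OF x(2) below_mult [OF below_refl y(2)]] x y b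
    by (intro jleI [of _ x _ y]) (auto simp: mult_assoc)
qed

lemma rle_imp_jle: assumes "rle a b" shows "jle a b"
proof -
  obtain x where x: "x \<in> carrier S" "a \<sqsubseteq> b \<cdot> x" and b: "b \<in> carrier S"
    using assms by (auto simp: rle_def)
  obtain y where y: "y \<in> carrier S" "b \<sqsubseteq> y \<cdot> b"
    using below_imp_lle [of b b] b by (auto simp: lle_def)
  show ?thesis
    using below_trans [OF x(2) below_mult [OF y(2) below_refl]] x y b
    by (intro jleI [of _ y _ x]) auto
qed

lemma below_imp_jle: "a \<sqsubseteq> b \<Longrightarrow> jle a b"
  by (intro lle_imp_jle below_imp_lle)

lemma lle_mult: "x \<in> carrier S \<Longrightarrow> a \<in> carrier S \<Longrightarrow> lle (x \<cdot> a) a"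
  by (rule lleI) auto

lemma rle_mult: "x \<in> carrier S \<Longrightarrow> a \<in> carrier S \<Longrightarrow> rle (a \<cdot> x) a"
  by (rule rleI) auto

lemma left_ideal_iff: "b \<in> carrier S \<Longrightarrow> a \<in> left_ideal S b \<longleftrightarrow> lle a b"
  using below_imp_lle [of a b] by (auto simp: left_ideal_def down_def lle_def below_def)

lemma right_ideal_iff: "b \<in> carrier S \<Longrightarrow> a \<in> right_ideal S b \<longleftrightarrow> rle a b"
  using below_imp_rle [of a b] by (auto simp: right_ideal_def down_def rle_def below_def)

text \<open>By regularity the generator and its one-sided multiples are absorbed into
  \<open>(SbS]\<close>.\<close>

lemma two_sided_ideal_iff: "b \<in> carrier S \<Longrightarrow> a \<in> two_sided_ideal S b \<longleftrightarrow> jle a b"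
proof
  assume b: "b \<in> carrier S" and "a \<in> two_sided_ideal S b"
  then consider "a \<sqsubseteq> b" | s where "s \<in> carrier S" "a \<sqsubseteq> s \<cdot> b"
    | s where "s \<in> carrier S" "a \<sqsubseteq> b \<cdot> s" | "jle a b"
    by (auto simp: two_sided_ideal_def down_def below_def jle_def)
  then show "jle a b"
    using b by cases (auto intro: below_imp_jle lle_imp_jle lleI rle_imp_jle rleI)
qed (auto simp: two_sided_ideal_def down_def below_def jle_def)

lemma green_L_iff: "(a, b) \<in> green_L S \<longleftrightarrow> lle a b \<and> lle b a"
proof -
  have "lle a b \<Longrightarrow> a \<in> carrier S \<and> b \<in> carrier S" for a b by (simp add: lle_def)
  moreover have "a \<in> carrier S \<Longrightarrow> lle a a" for a by (simp add: below_imp_lle)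
  ultimately show ?thesis
    by (simp add: green_L_def left_ideal_iff set_eq_iff cong: conj_cong) (meson lle_trans)
qed

lemma green_R_iff: "(a, b) \<in> green_R S \<longleftrightarrow> rle a b \<and> rle b a"
proof -
  have "rle a b \<Longrightarrow> a \<in> carrier S \<and> b \<in> carrier S" for a b by (simp add: rle_def)
  moreover have "a \<in> carrier S \<Longrightarrow> rle a a" for a by (simp add: below_imp_rle)
  ultimately show ?thesis
    by (simp add: green_R_def right_ideal_iff set_eq_iff cong: conj_cong) (meson rle_trans)
qed

lemma green_J_iff: "(a, b) \<in> green_J S \<longleftrightarrow> jle a b \<and> jle b a"
proof -
  have "jle a b \<Longrightarrow> a \<in> carrier S \<and> b \<in> carrier S" for a b by (simp add: jle_def)
  moreover have "a \<in> carrier S \<Longrightarrow> jle a a" for a by (simp add: below_imp_jle)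
  ultimately show ?thesis
    by (simp add: green_J_def two_sided_ideal_iff set_eq_iff cong: conj_cong) (meson jle_trans)
qed

lemma green_H_iff: "(a, b) \<in> green_H S \<longleftrightarrow> lle a b \<and> lle b a \<and> rle a b \<and> rle b a"
  by (auto simp: green_H_def green_L_iff green_R_iff)

lemma green_H_sym: "(a, b) \<in> green_H S \<Longrightarrow> (b, a) \<in> green_H S"
  by (auto simp: green_H_iff)

lemma green_trans:
  "(a, b) \<in> green_L S \<Longrightarrow> (b, c) \<in> green_L S \<Longrightarrow> (a, c) \<in> green_L S"
  "(a, b) \<in> green_R S \<Longrightarrow> (b, c) \<in> green_R S \<Longrightarrow> (a, c) \<in> green_R S"
  "(a, b) \<in> green_H S \<Longrightarrow> (b, c) \<in> green_H S \<Longrightarrow> (a, c) \<in> green_H S"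
  by (auto simp: green_L_iff green_R_iff green_H_iff intro: lle_trans rle_trans)

section \<open>Commutation of ordered idempotents and the collapse of the preorders\<close>

text \<open>Regularity of \<open>ea\<close>, used twice, gives
  \<open>ea \<le> (eac)(ea)(cea)\<close>. Rotating \<open>eac\<close> brings \<open>a\<close> to the
  left end, and rotating \<open>cea\<close> brings \<open>e\<close> to the right end.\<close>

lemma H_commutative_if_rotations:
  assumes rot: "\<And>a b. a \<in> carrier S \<Longrightarrow> b \<in> carrier S \<Longrightarrow> a \<cdot> b \<in> ordered_idempotents S \<Longrightarrow>
      b \<cdot> a \<in> ordered_idempotents S \<Longrightarrow> (a \<cdot> b, b \<cdot> a) \<in> green_H S"
    and e: "e \<in> carrier S" and a: "a \<in> carrier S"
  shows "H_commutative S e a"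
proof -
  obtain c where c: "c \<in> carrier S" "e \<cdot> a \<sqsubseteq> e \<cdot> a \<cdot> c \<cdot> (e \<cdot> a)" "c \<sqsubseteq> c \<cdot> (e \<cdot> a) \<cdot> c"
    using ex_inverse [of "e \<cdot> a"] e a by blast
  have eac: "e \<cdot> (a \<cdot> c) \<in> ordered_idempotents S" and cea: "c \<cdot> e \<cdot> a \<in> ordered_idempotents S"
    using idempotent_mult_inverse [OF _ _ c(2)] e a c(1)
    by (auto simp: ordered_idempotents_iff mult_assoc)
  \<comment> \<open>This idempotent needs the other half of the inverse condition,
    \<open>c \<le> c(ea)c\<close>. It is recorded in two bracketings because \<open>rot\<close> is
    applied once to the factors \<open>e\<close> and \<open>ac\<close>, once to \<open>ce\<close>
    and \<open>a\<close>.\<close>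
  have "a \<cdot> c \<cdot> e \<sqsubseteq> a \<cdot> (c \<cdot> (e \<cdot> a) \<cdot> c) \<cdot> e"
    using e a c by (intro below_mult) auto
  then have ace: "a \<cdot> c \<cdot> e \<in> ordered_idempotents S" "a \<cdot> (c \<cdot> e) \<in> ordered_idempotents S"
    using e a c(1) by (auto simp: ordered_idempotents_iff mult_assoc)
  obtain y where y: "y \<in> carrier S" "e \<cdot> (a \<cdot> c) \<sqsubseteq> a \<cdot> c \<cdot> e \<cdot> y"
    using rot [OF e _ eac ace(1)] a c(1) by (auto simp: green_H_iff rle_def)
  obtain z where z: "z \<in> carrier S" "c \<cdot> e \<cdot> a \<sqsubseteq> z \<cdot> (a \<cdot> (c \<cdot> e))"
    using rot [OF _ a cea ace(2)] e c(1) by (auto simp: green_H_iff lle_def)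
  have "e \<cdot> a \<sqsubseteq> e \<cdot> a \<cdot> c \<cdot> (e \<cdot> a)" by (fact c)
  also have "\<dots> \<sqsubseteq> e \<cdot> a \<cdot> c \<cdot> (e \<cdot> a \<cdot> c \<cdot> (e \<cdot> a))"
    using e a c by (intro below_mult [OF below_refl c(2)]) auto
  also have "\<dots> = e \<cdot> (a \<cdot> c) \<cdot> (e \<cdot> a) \<cdot> (c \<cdot> e \<cdot> a)"
    using e a c by (simp add: mult_assoc)
  also have "\<dots> \<sqsubseteq> a \<cdot> c \<cdot> e \<cdot> y \<cdot> (e \<cdot> a) \<cdot> (z \<cdot> (a \<cdot> (c \<cdot> e)))"
    using e a c by (intro below_mult [OF below_mult [OF y(2) below_refl] z(2)]) auto
  also have "\<dots> = a \<cdot> (c \<cdot> e \<cdot> y \<cdot> (e \<cdot> a) \<cdot> z \<cdot> (a \<cdot> c)) \<cdot> e"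
    using e a c y z by (simp add: mult_assoc)
  finally show ?thesis
    using e a c y z by (auto simp: H_commutative_iff)
qed

text \<open>\<open>comm\<close> only moves an idempotent left factor past an element, so the swap of
  \<open>a\<close> with \<open>e\<close> on the right is reached through two other idempotents:
  \<open>q\<close> yields a bound that starts with \<open>e\<close>, and \<open>b \<cdot> a\<close>
  yields one that ends with \<open>a\<close>. The two bounds are then multiplied.\<close>

lemma H_commutative_converse:
  assumes comm: "\<And>e a. e \<in> ordered_idempotents S \<Longrightarrow> a \<in> carrier S \<Longrightarrow> H_commutative S e a"
    and idem: "e \<in> ordered_idempotents S" and a: "a \<in> carrier S"
  shows "H_commutative S a e"
proof -
  have swap: "\<exists>x\<in>carrier S. e \<cdot> a \<sqsubseteq> a \<cdot> x \<cdot> e" if "e \<sqsubseteq> e \<cdot> e" "a \<in> carrier S" for e a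
    using comm [of e a] that below_carrier [OF that(1)]
    by (simp add: ordered_idempotents_iff H_commutative_iff)
  have ee: "e \<sqsubseteq> e \<cdot> e" using idem by (simp add: ordered_idempotents_iff)
  have e: "e \<in> carrier S" using below_carrier [OF ee] by simp
  obtain c where c: "c \<in> carrier S" "a \<cdot> e \<sqsubseteq> a \<cdot> e \<cdot> c \<cdot> (a \<cdot> e)"
    using ex_inverse [of "a \<cdot> e"] e a by blast
  obtain x where x: "x \<in> carrier S" "e \<cdot> c \<sqsubseteq> c \<cdot> x \<cdot> e" using swap [OF ee c(1)] by blast
  \<comment> \<open>\<open>p\<close> takes over the role of the multiplier \<open>c\<close> in the
    regularity of \<open>a \<cdot> e\<close>. Unlike \<open>c\<close> it ends in \<open>e\<close>,
    hence \<open>p \<le> pe\<close>.\<close>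
  define p where "p = c \<cdot> x \<cdot> e"
  have p: "p \<in> carrier S" using c x e by (simp add: p_def)
  have pe: "p \<sqsubseteq> p \<cdot> e"
    using below_mult [OF below_refl ee, of "c \<cdot> x"] c x e by (simp add: p_def mult_assoc)
  have "a \<cdot> e \<sqsubseteq> a \<cdot> e \<cdot> c \<cdot> (a \<cdot> e)" by (fact c)
  also have "\<dots> \<sqsubseteq> a \<cdot> (e \<cdot> e) \<cdot> c \<cdot> (a \<cdot> e)"
    using a e c ee by (intro below_mult) auto
  also have "\<dots> = a \<cdot> e \<cdot> (e \<cdot> c) \<cdot> (a \<cdot> e)" using a e c by (simp add: mult_assoc)
  also have "\<dots> \<sqsubseteq> a \<cdot> e \<cdot> p \<cdot> (a \<cdot> e)"
    using a e x(2) unfolding p_def by (intro below_mult [OF below_mult [OF below_refl] below_refl]) auto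
  finally have ae: "a \<cdot> e \<sqsubseteq> a \<cdot> e \<cdot> p \<cdot> (a \<cdot> e)" .
  \<comment> \<open>\<open>q\<close> is an ordered idempotent since
    \<open>ae \<le> (ae)p(ae)\<close>, and it inherits \<open>q \<le> qe\<close> from
    \<open>p\<close>. Commuting \<open>q\<close> past \<open>e\<close> therefore bounds
    \<open>q\<close> itself by a product starting with \<open>e\<close>.\<close>
  define q where "q = a \<cdot> e \<cdot> p"
  have q: "q \<in> carrier S" using a e p by (simp add: q_def)
  have "q \<sqsubseteq> q \<cdot> q"
    unfolding q_def using idempotent_mult_inverse(1) [OF _ p ae] a e by blast
  then obtain y where y: "y \<in> carrier S" "q \<cdot> e \<sqsubseteq> e \<cdot> y \<cdot> q"
    using swap [of q e] e by blast
  have "q \<sqsubseteq> q \<cdot> e"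
    using below_mult [OF below_refl pe, of "a \<cdot> e"] a e p by (simp add: q_def mult_assoc)
  also note y(2)
  finally have qy: "q \<sqsubseteq> e \<cdot> y \<cdot> q" .
  obtain b where b: "b \<in> carrier S" "a \<sqsubseteq> a \<cdot> b \<cdot> a" using ex_inverse [OF a] by blast
  \<comment> \<open>In \<open>ae \<le> a(ba)e\<close> the idempotent \<open>ba\<close> is moved past
    \<open>e\<close>, which leaves \<open>a\<close> at the right end.\<close>
  obtain w where w: "w \<in> carrier S" "b \<cdot> a \<cdot> e \<sqsubseteq> e \<cdot> w \<cdot> (b \<cdot> a)"
    using swap [OF idempotent_mult_inverse(2) [OF a b] e] by blast
  have "a \<cdot> e \<sqsubseteq> a \<cdot> b \<cdot> a \<cdot> e" using a b e by (intro below_mult) auto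
  also have "\<dots> = a \<cdot> (b \<cdot> a \<cdot> e)" using a b e by (simp add: mult_assoc)
  also have "\<dots> \<sqsubseteq> a \<cdot> (e \<cdot> w \<cdot> (b \<cdot> a))" using a by (intro below_mult [OF below_refl w(2)])
  finally have aw: "a \<cdot> e \<sqsubseteq> a \<cdot> (e \<cdot> w \<cdot> (b \<cdot> a))" .
  have "a \<cdot> e \<sqsubseteq> q \<cdot> (a \<cdot> e)" using ae by (simp add: q_def)
  also have "\<dots> \<sqsubseteq> e \<cdot> y \<cdot> q \<cdot> (a \<cdot> (e \<cdot> w \<cdot> (b \<cdot> a)))"
    using qy aw by (rule below_mult)
  also have "\<dots> = e \<cdot> (y \<cdot> q \<cdot> (a \<cdot> (e \<cdot> w \<cdot> b))) \<cdot> a"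
    using a e b w y q by (simp add: mult_assoc)
  finally show ?thesis
    using a e b w y q by (auto simp: H_commutative_iff)
qed

text \<open>Replace \<open>b\<close> by \<open>bcb\<close> in \<open>a \<le> xby\<close>. The
  idempotent \<open>bc\<close> travels left across \<open>x\<close> by the converse commutation, so
  \<open>b\<close> comes to the front; the idempotent \<open>cb\<close> travels right across
  \<open>y\<close>, so \<open>b\<close> comes to the end.\<close>

lemma jle_imp_lle_rle_if_H_commutative:
  assumes comm: "\<And>e a. e \<in> ordered_idempotents S \<Longrightarrow> a \<in> carrier S \<Longrightarrow> H_commutative S e a"
    and "jle a b"
  shows "lle a b \<and> rle a b"
proof -
  obtain x y where b: "b \<in> carrier S" and xy: "x \<in> carrier S" "y \<in> carrier S"
    and le: "a \<sqsubseteq> x \<cdot> b \<cdot> y"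
    using assms(2) by (auto simp: jle_def)
  obtain c where c: "c \<in> carrier S" "b \<sqsubseteq> b \<cdot> c \<cdot> b" using ex_inverse [OF b] by blast
  have idem: "b \<cdot> c \<in> ordered_idempotents S" "c \<cdot> b \<in> ordered_idempotents S"
    using idempotent_mult_inverse [OF b c] by (auto simp: ordered_idempotents_iff)
  obtain u where u: "u \<in> carrier S" "x \<cdot> (b \<cdot> c) \<sqsubseteq> b \<cdot> c \<cdot> u \<cdot> x"
    using H_commutative_converse [OF comm idem(1) xy(1)] b c xy by (auto simp: H_commutative_iff)
  obtain v where v: "v \<in> carrier S" "c \<cdot> b \<cdot> y \<sqsubseteq> y \<cdot> v \<cdot> (c \<cdot> b)"
    using comm [OF idem(2) xy(2)] b c xy by (auto simp: H_commutative_iff)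
  have "a \<sqsubseteq> x \<cdot> (b \<cdot> c \<cdot> b) \<cdot> y"
    using below_trans [OF le] b c xy by (auto intro!: below_mult)
  also have "\<dots> = x \<cdot> (b \<cdot> c) \<cdot> (b \<cdot> y)" using b c xy by (simp add: mult_assoc)
  also have "\<dots> \<sqsubseteq> b \<cdot> c \<cdot> u \<cdot> x \<cdot> (b \<cdot> y)" using b xy by (intro below_mult [OF u(2) below_refl]) auto
  also have "\<dots> = b \<cdot> (c \<cdot> u \<cdot> x \<cdot> (b \<cdot> y))" using b c u xy by (simp add: mult_assoc)
  finally have "rle a b" using b c u xy by (auto intro: rleI)
  moreover have "lle a b"
  proof -
    have "a \<sqsubseteq> x \<cdot> (b \<cdot> c \<cdot> b) \<cdot> y"
      using below_trans [OF le] b c xy by (auto intro!: below_mult)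
    also have "\<dots> = x \<cdot> b \<cdot> (c \<cdot> b \<cdot> y)" using b c xy by (simp add: mult_assoc)
    also have "\<dots> \<sqsubseteq> x \<cdot> b \<cdot> (y \<cdot> v \<cdot> (c \<cdot> b))" using b xy by (intro below_mult [OF below_refl v(2)]) auto
    also have "\<dots> = x \<cdot> b \<cdot> (y \<cdot> v \<cdot> c) \<cdot> b" using b c v xy by (simp add: mult_assoc)
    finally show ?thesis using b c v xy by (auto intro: lleI)
  qed
  ultimately show ?thesis by simp
qed

section \<open>The rotation condition (3) derived from (5), from (1) and from (2)\<close>

lemma green_J_mult_swap:
  assumes "a \<in> carrier S" "b \<in> carrier S"
    and "a \<cdot> b \<in> ordered_idempotents S" "b \<cdot> a \<in> ordered_idempotents S"
  shows "(a \<cdot> b, b \<cdot> a) \<in> green_J S"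
  using assms
  by (auto simp: green_J_iff ordered_idempotents_iff mult_assoc
      intro!: jleI [of "a \<cdot> b" a _ b] jleI [of "b \<cdot> a" b _ a])

lemma completely_regular_imp_green_H_idempotent:
  assumes "completely_regular_ordered_semigroup S" and a: "a \<in> carrier S"
  obtains e where "e \<in> ordered_idempotents S" "(a, e) \<in> green_H S"
proof -
  interpret completely_regular_ordered_semigroup S by fact
  obtain s where s: "s \<in> carrier S" "a \<sqsubseteq> a \<cdot> a \<cdot> s \<cdot> (a \<cdot> a)"
    using completely_regular [OF a] a by (auto simp: down_def below_def)
  \<comment> \<open>Substituting \<open>a \<le> aasaa\<close> for an inner factor \<open>a\<close>
    of its own right-hand side yields \<open>ea\<close> or \<open>ae\<close>, depending on whether
    the factor just after or just before \<open>s\<close> is replaced.\<close>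
  define e where "e = a \<cdot> a \<cdot> s \<cdot> (a \<cdot> a) \<cdot> (s \<cdot> (a \<cdot> a))"
  have e: "e \<in> carrier S" using a s by (simp add: e_def)
  have "a \<sqsubseteq> a \<cdot> a \<cdot> s \<cdot> a \<cdot> a" using a s by (simp add: mult_assoc)
  also have "\<dots> \<sqsubseteq> a \<cdot> a \<cdot> s \<cdot> (a \<cdot> a \<cdot> s \<cdot> (a \<cdot> a)) \<cdot> a"
    using a s by (intro below_mult [OF below_mult [OF below_refl s(2)] below_refl]) auto
  also have "\<dots> = e \<cdot> a" using a s by (simp add: e_def mult_assoc)
  finally have ea: "a \<sqsubseteq> e \<cdot> a" .
  have "a \<sqsubseteq> a \<cdot> (a \<cdot> (s \<cdot> (a \<cdot> a)))" using a s by (simp add: mult_assoc)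
  also have "\<dots> \<sqsubseteq> a \<cdot> ((a \<cdot> a \<cdot> s \<cdot> (a \<cdot> a)) \<cdot> (s \<cdot> (a \<cdot> a)))"
    using a s by (intro below_mult [OF below_refl below_mult [OF s(2) below_refl]]) auto
  also have "\<dots> = a \<cdot> e" using a s by (simp add: e_def mult_assoc)
  finally have ae: "a \<sqsubseteq> a \<cdot> e" .
  \<comment> \<open>\<open>w\<close> and \<open>z\<close> are \<open>e\<close> without its first,
    respectively last, factor \<open>a\<close>. They show that \<open>a\<close> divides
    \<open>e\<close> on both sides, and \<open>a \<le> ea\<close> multiplied by \<open>w\<close> is
    the idempotency of \<open>e\<close>.\<close>
  define w where "w = a \<cdot> s \<cdot> (a \<cdot> a) \<cdot> (s \<cdot> (a \<cdot> a))"
  define z where "z = a \<cdot> a \<cdot> s \<cdot> (a \<cdot> a) \<cdot> (s \<cdot> a)"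
  have wz: "w \<in> carrier S" "z \<in> carrier S" using a s by (simp_all add: w_def z_def)
  have aw: "e = a \<cdot> w" and za: "e = z \<cdot> a"
    using a s by (simp_all add: e_def w_def z_def mult_assoc)
  have "e \<sqsubseteq> e \<cdot> e"
    using below_mult [OF ea below_refl [OF wz(1)]] a e wz by (simp add: aw mult_assoc)
  moreover have "(a, e) \<in> green_H S"
    using a e wz ea ae lleI [OF ae] rleI [OF ea] lle_mult [of z a] rle_mult [of w a]
    by (auto simp: green_H_iff simp flip: aw za)
  ultimately show ?thesis using that by (auto simp: ordered_idempotents_iff)
qed

lemma inverse_imp_green_H_if_green_L:
  assumes inv: "inverse_ordered_semigroup S"
    and idem: "e \<in> ordered_idempotents S" "f \<in> ordered_idempotents S"
    and "(e, f) \<in> green_L S"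
  shows "(e, f) \<in> green_H S"
proof -
  have ee: "e \<sqsubseteq> e \<cdot> e" and ff: "f \<sqsubseteq> f \<cdot> f"
    using idem by (simp_all add: ordered_idempotents_iff)
  have C: "e \<in> carrier S" "f \<in> carrier S"
    using below_carrier [OF ee] below_carrier [OF ff] by auto
  obtain x y where x: "x \<in> carrier S" "e \<sqsubseteq> x \<cdot> f" and y: "y \<in> carrier S" "f \<sqsubseteq> y \<cdot> e"
    using assms(4) by (auto simp: green_L_iff lle_def)
  txt \<open>\<open>a\<close> is \<open>\<R>\<close>-related to \<open>e\<close>, and both \<open>a\<close> and \<open>f\<close> are inverses of \<open>b\<close>.\<close>
  define a where "a = e \<cdot> x \<cdot> f"
  define b where "b = f \<cdot> y \<cdot> e"
  have ab: "a \<in> carrier S" "b \<in> carrier S" using C x y by (simp_all add: a_def b_def)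
  have ea: "e \<sqsubseteq> a"
    using below_trans [OF ee below_mult [OF below_refl [OF C(1)] x(2)]] C x
    by (simp add: a_def mult_assoc)
  have fb: "f \<sqsubseteq> b"
    using below_trans [OF ff below_mult [OF below_refl [OF C(2)] y(2)]] C y
    by (simp add: b_def mult_assoc)
  have af: "a \<sqsubseteq> a \<cdot> f"
    using below_mult [OF below_refl [of "e \<cdot> x"] ff] C x by (simp add: a_def mult_assoc)
  have be: "b \<sqsubseteq> b \<cdot> e"
    using below_mult [OF below_refl [of "f \<cdot> y"] ee] C y by (simp add: b_def mult_assoc)
  have fb': "b \<sqsubseteq> f \<cdot> b"
    using below_mult [OF ff below_refl [of "y \<cdot> e"]] C y by (simp add: b_def mult_assoc)
  \<comment> \<open>The idempotents absorbed on the right are enlarged by \<open>f \<le> b\<close>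
    and \<open>e \<le> a\<close>. Applying both results in turn gives \<open>a \<le> aba\<close> and
    \<open>b \<le> bab\<close>.\<close>
  have a_ab: "a \<sqsubseteq> a \<cdot> b" and b_ba: "b \<sqsubseteq> b \<cdot> a"
    using below_trans [OF af below_mult [OF below_refl fb]]
      below_trans [OF be below_mult [OF below_refl ea]] ab by auto
  have "a \<cdot> b \<sqsubseteq> a \<cdot> (b \<cdot> a)" "b \<cdot> a \<sqsubseteq> b \<cdot> (a \<cdot> b)"
    using below_mult [OF below_refl b_ba, of a] below_mult [OF below_refl a_ab, of b] ab by auto
  then have "a \<in> inverses S b"
    using below_trans [OF a_ab] below_trans [OF b_ba] ab by (simp add: inverses_iff mult_assoc)
  moreover have "f \<in> inverses S b"
  proof -
    have "f \<sqsubseteq> f \<cdot> b \<cdot> f"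
      using below_trans [OF ff below_mult [OF below_trans [OF ff below_mult [OF below_refl fb]]
            below_refl]] C by simp
    moreover have "b \<sqsubseteq> b \<cdot> f \<cdot> b"
      using below_trans [OF fb' below_mult [OF below_trans [OF ff below_mult [OF fb below_refl]]
            below_refl]] C ab by simp
    ultimately show ?thesis using ab by (simp add: inverses_iff)
  qed
  ultimately have "(a, f) \<in> green_R S"
    using inverse_ordered_semigroup.inverses_green_H [OF inv ab(2)] by (auto simp: green_H_def)
  moreover have "(e, a) \<in> green_R S"
    using below_imp_rle [OF ea] rle_mult [of "x \<cdot> f" e] C x
    by (simp add: green_R_iff a_def mult_assoc)
  ultimately show ?thesis using assms(4) green_trans(2) by (auto simp: green_H_def)
qed

text \<open>Left-right dual of \<open>inverse_imp_green_H_if_green_L\<close>: here \<open>a\<close>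
  is \<L>-related to \<open>e\<close>, and again \<open>a\<close> and \<open>f\<close> are both
  inverses of \<open>b\<close>.\<close>

lemma inverse_imp_green_H_if_green_R:
  assumes inv: "inverse_ordered_semigroup S"
    and idem: "e \<in> ordered_idempotents S" "f \<in> ordered_idempotents S"
    and "(e, f) \<in> green_R S"
  shows "(e, f) \<in> green_H S"
proof -
  have ee: "e \<sqsubseteq> e \<cdot> e" and ff: "f \<sqsubseteq> f \<cdot> f"
    using idem by (simp_all add: ordered_idempotents_iff)
  have C: "e \<in> carrier S" "f \<in> carrier S"
    using below_carrier [OF ee] below_carrier [OF ff] by auto
  obtain x y where x: "x \<in> carrier S" "e \<sqsubseteq> f \<cdot> x" and y: "y \<in> carrier S" "f \<sqsubseteq> e \<cdot> y"
    using assms(4) by (auto simp: green_R_iff rle_def)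
  define a where "a = f \<cdot> x \<cdot> e"
  define b where "b = e \<cdot> y \<cdot> f"
  have ab: "a \<in> carrier S" "b \<in> carrier S" using C x y by (simp_all add: a_def b_def)
  have ea: "e \<sqsubseteq> a"
    using below_trans [OF ee below_mult [OF x(2) below_refl [OF C(1)]]] by (simp add: a_def)
  have fb: "f \<sqsubseteq> b"
    using below_trans [OF ff below_mult [OF y(2) below_refl [OF C(2)]]] by (simp add: b_def)
  have fa: "a \<sqsubseteq> f \<cdot> a"
    using below_mult [OF ff below_refl [of "x \<cdot> e"]] C x by (simp add: a_def mult_assoc)
  have eb: "b \<sqsubseteq> e \<cdot> b"
    using below_mult [OF ee below_refl [of "y \<cdot> f"]] C y by (simp add: b_def mult_assoc)
  have bf: "b \<sqsubseteq> b \<cdot> f"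
    using below_mult [OF below_refl [of "e \<cdot> y"] ff] C y by (simp add: b_def mult_assoc)
  have a_ba: "a \<sqsubseteq> b \<cdot> a" and b_ab: "b \<sqsubseteq> a \<cdot> b"
    using below_trans [OF fa below_mult [OF fb below_refl]]
      below_trans [OF eb below_mult [OF ea below_refl]] ab by auto
  have "b \<cdot> a \<sqsubseteq> a \<cdot> b \<cdot> a" "a \<cdot> b \<sqsubseteq> b \<cdot> a \<cdot> b"
    using below_mult [OF b_ab below_refl, of a] below_mult [OF a_ba below_refl, of b] ab by auto
  then have "a \<in> inverses S b"
    using below_trans [OF a_ba] below_trans [OF b_ab] ab by (simp add: inverses_iff)
  moreover have "f \<in> inverses S b"
  proof -
    have "f \<sqsubseteq> f \<cdot> b \<cdot> f"
      using below_trans [OF ff below_mult [OF below_trans [OF ff below_mult [OF below_refl fb]]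
            below_refl]] C by simp
    moreover have "b \<sqsubseteq> b \<cdot> (f \<cdot> b)"
      using below_trans [OF bf below_mult [OF below_refl below_trans [OF ff
              below_mult [OF below_refl fb]]]] C ab by simp
    ultimately show ?thesis using C ab by (simp add: inverses_iff mult_assoc)
  qed
  ultimately have "(a, f) \<in> green_L S"
    using inverse_ordered_semigroup.inverses_green_H [OF inv ab(2)] by (auto simp: green_H_def)
  moreover have "(e, a) \<in> green_L S"
    using below_imp_lle [OF ea] lle_mult [of "f \<cdot> x" e] C x by (simp add: green_L_iff a_def)
  ultimately show ?thesis using assms(4) green_trans(1) by (auto simp: green_H_def)
qed

lemma inverse_completely_regular_imp_rotations:
  assumes inv: "inverse_ordered_semigroup S"
    and cr: "completely_regular_ordered_semigroup S"
    and C: "a \<in> carrier S" "b \<in> carrier S"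
    and idem: "a \<cdot> b \<in> ordered_idempotents S" "b \<cdot> a \<in> ordered_idempotents S"
  shows "(a \<cdot> b, b \<cdot> a) \<in> green_H S"
proof -
  define c where "c = a \<cdot> b \<cdot> a"
  have c: "c \<in> carrier S" using C by (simp add: c_def)
  obtain e where e: "e \<in> ordered_idempotents S" "(c, e) \<in> green_H S"
    using completely_regular_imp_green_H_idempotent [OF cr c] by blast
  have "(a \<cdot> b, c) \<in> green_R S"
    using rleI [of "a \<cdot> b" c b] rle_mult [of a "a \<cdot> b"] idem(1) C
    by (simp add: green_R_iff ordered_idempotents_iff c_def mult_assoc)
  then have R: "(a \<cdot> b, e) \<in> green_R S"
    using e(2) green_trans(2) by (auto simp: green_H_def)
  have "(b \<cdot> a, c) \<in> green_L S"
    using lleI [of "b \<cdot> a" b c] lle_mult [of a "b \<cdot> a"] idem(2) C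
    by (simp add: green_L_iff ordered_idempotents_iff c_def mult_assoc)
  then have L: "(b \<cdot> a, e) \<in> green_L S"
    using e(2) green_trans(1) by (auto simp: green_H_def)
  show ?thesis
    using inverse_imp_green_H_if_green_R [OF inv idem(1) e(1) R]
      inverse_imp_green_H_if_green_L [OF inv idem(2) e(1) L] green_H_sym green_trans(3) by blast
qed

text \<open>Two elements of one class divide each other on both sides with multipliers from the
  class, hence with multipliers from \<open>S\<close>.\<close>

lemma semilattice_of_group_likes_imp_rotations:
  assumes "complete_semilattice_of_group_likes S"
    and C: "a \<in> carrier S" "b \<in> carrier S"
  shows "(a \<cdot> b, b \<cdot> a) \<in> green_H S"
proof -
  obtain \<rho> where \<rho>: "complete_semilattice_congruence S \<rho>"
    and gl: "\<And>T. T \<in> carrier S // \<rho> \<Longrightarrow> group_like_ordered_semigroup (S\<lparr>carrier := T\<rparr>)"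
    using assms(1) by (auto simp: complete_semilattice_of_group_likes_def)
  have eq: "equiv (carrier S) \<rho>" and swap: "(a \<cdot> b, b \<cdot> a) \<in> \<rho>"
    using \<rho> C
    by (auto simp: complete_semilattice_congruence_def semilattice_congruence_def os_congruence_def)
  define T where "T = \<rho> `` {a \<cdot> b}"
  have T: "T \<in> carrier S // \<rho>" "T \<subseteq> carrier S" "a \<cdot> b \<in> T" "b \<cdot> a \<in> T"
    using eq swap C equiv_class_self [OF eq, of "a \<cdot> b"]
    by (auto simp: T_def intro: quotientI dest: equiv_type)
  interpret T: group_like_ordered_semigroup "S\<lparr>carrier := T\<rparr>" by (rule gl [OF T(1)])
  have l: "lle u v" and r: "rle u v" if "u \<in> T" "v \<in> T" for u v
    using T.left_group_like [of u v] T.right_group_like [of v u] that T(2)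
    by (auto simp: down_def lle_def rle_def below_def)
  show ?thesis using T(3,4) by (auto simp: green_H_iff l r)
qed

section \<open>Structure of \<open>S\<close> when the three divisibility preorders coincide\<close>

context
  assumes jle_imp: "\<And>a b. jle a b \<Longrightarrow> lle a b \<and> rle a b"
begin

lemma lle_iff_jle: "lle a b \<longleftrightarrow> jle a b" and rle_iff_jle: "rle a b \<longleftrightarrow> jle a b"
  by (blast dest: jle_imp lle_imp_jle rle_imp_jle)+

lemma green_relations_coincide:
  "green_H S = green_L S" "green_L S = green_R S" "green_R S = green_J S"
  by (auto simp: set_eq_iff green_H_iff green_L_iff green_R_iff green_J_iff lle_iff_jle rle_iff_jle)

text \<open>\<open>d \<le> dad\<close> and \<open>a \<le> ada\<close> put every inverse
  \<open>d\<close> of \<open>a\<close> into the \<J>-class of \<open>a\<close>, which is now an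
  \<H>-class.\<close>

lemma inverse_if_jle_imp: "inverse_ordered_semigroup S"
proof
  fix a b c assume a: "a \<in> carrier S" and b: "b \<in> inverses S a" and c: "c \<in> inverses S a"
  have J: "jle d a \<and> jle a d" if "d \<in> inverses S a" for d
    using that a jleI [of d d a d] jleI [of a a d a]
    by (auto simp: inverses_iff dest: below_carrier)
  show "(b, c) \<in> green_H S"
    using J [OF b] J [OF c] by (auto simp: green_H_iff lle_iff_jle rle_iff_jle intro: jle_trans)
qed

text \<open>Left multiples of \<open>a\<close> are now bounded by right multiples and conversely:
  \<open>ba \<le> ax\<close> and \<open>ab \<le> ya\<close>. So \<open>a \<le> aax\<close> and
  \<open>a \<le> yaa\<close>, and these replace the outer factors in
  \<open>a \<le> aba\<close>.\<close>

lemma completely_regular_if_jle_imp: "completely_regular_ordered_semigroup S"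
proof
  fix a assume a: "a \<in> carrier S"
  obtain b where b: "b \<in> carrier S" "a \<sqsubseteq> a \<cdot> b \<cdot> a" using ex_inverse [OF a] by blast
  obtain x where x: "x \<in> carrier S" "b \<cdot> a \<sqsubseteq> a \<cdot> x"
    using jle_imp [OF lle_imp_jle [OF lle_mult [OF b(1) a]]] by (auto simp: rle_def)
  obtain y where y: "y \<in> carrier S" "a \<cdot> b \<sqsubseteq> y \<cdot> a"
    using jle_imp [OF rle_imp_jle [OF rle_mult [OF b(1) a]]] by (auto simp: lle_def)
  have "a \<sqsubseteq> a \<cdot> (b \<cdot> a)" using a b by (simp add: mult_assoc)
  also have "\<dots> \<sqsubseteq> a \<cdot> (a \<cdot> x)" by (rule below_mult [OF below_refl [OF a] x(2)])
  finally have ax: "a \<sqsubseteq> a \<cdot> a \<cdot> x" using a x by (simp add: mult_assoc)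
  note b(2)
  also have "a \<cdot> b \<cdot> a \<sqsubseteq> y \<cdot> a \<cdot> a" by (rule below_mult [OF y(2) below_refl [OF a]])
  finally have ya: "a \<sqsubseteq> y \<cdot> (a \<cdot> a)" using a y by (simp add: mult_assoc)
  note b(2)
  also have "a \<cdot> b \<cdot> a \<sqsubseteq> a \<cdot> a \<cdot> x \<cdot> b \<cdot> (y \<cdot> (a \<cdot> a))"
    by (rule below_mult [OF below_mult [OF ax below_refl [OF b(1)]] ya])
  also have "\<dots> = a \<cdot> a \<cdot> (x \<cdot> b \<cdot> y) \<cdot> (a \<cdot> a)" using a b x y by (simp add: mult_assoc)
  finally show "a \<in> down S {(a \<cdot> a) \<cdot> s \<cdot> (a \<cdot> a) |s. s \<in> carrier S}"
    using a b x y by (auto simp: down_def below_def)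
qed

lemma jle_square:
  assumes a: "a \<in> carrier S" shows "jle a (a \<cdot> a)"
proof -
  interpret completely_regular_ordered_semigroup S by (rule completely_regular_if_jle_imp)
  obtain s where s: "s \<in> carrier S" "a \<sqsubseteq> (a \<cdot> a) \<cdot> (s \<cdot> (a \<cdot> a))"
    using completely_regular [OF a] a by (auto simp: down_def below_def mult_assoc)
  then show ?thesis using a by (intro rle_imp_jle rleI [OF s(2)]) auto
qed

text \<open>Squaring places \<open>ba\<close> inside the product:
  \<open>(ab)(ab) = a(ba)b\<close>.\<close>

lemma jle_mult_swap:
  assumes "a \<in> carrier S" "b \<in> carrier S" shows "jle (a \<cdot> b) (b \<cdot> a)"
proof -
  have "jle (a \<cdot> b) (a \<cdot> b \<cdot> (a \<cdot> b))" using assms by (simp add: jle_square)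
  also have "jle (a \<cdot> b \<cdot> (a \<cdot> b)) (b \<cdot> a)"
    using assms by (intro jleI [of _ a _ b]) (auto simp: mult_assoc)
  finally show ?thesis .
qed

lemma jle_mult:
  assumes "jle a b" and c: "c \<in> carrier S"
  shows "jle (c \<cdot> a) (c \<cdot> b)" "jle (a \<cdot> c) (b \<cdot> c)"
  using rle_mult_left [of a b c] lle_mult_right [of a b c] assms
  by (simp_all add: lle_iff_jle rle_iff_jle)

lemma complete_semilattice_congruence_green_J: "complete_semilattice_congruence S (green_J S)"
proof -
  have "equiv (carrier S) (green_J S)"
    by (auto simp: equiv_def refl_on_def sym_def trans_def green_J_def)
  moreover have "(c \<cdot> a, c \<cdot> b) \<in> green_J S" "(a \<cdot> c, b \<cdot> c) \<in> green_J S"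
    if "(a, b) \<in> green_J S" "c \<in> carrier S" for a b c
    using that jle_mult by (auto simp: green_J_iff)
  moreover have "(a, a \<cdot> a) \<in> green_J S" if "a \<in> carrier S" for a
    using that jle_square lle_imp_jle lle_mult by (auto simp: green_J_iff)
  moreover have "(a \<cdot> b, b \<cdot> a) \<in> green_J S" if "a \<in> carrier S" "b \<in> carrier S" for a b
    using that jle_mult_swap by (auto simp: green_J_iff)
  moreover have "(a, a \<cdot> b) \<in> green_J S"
    if "a \<in> carrier S" "b \<in> carrier S" "a \<preceq> b" for a b
  proof -
    \<comment> \<open>Completeness passes through the square: \<open>a\<close> is \<J>-below
      \<open>aa\<close>, and \<open>aa \<le> ab\<close>.\<close>
    have "a \<sqsubseteq> b" using that by (simp add: below_def)
    then have "a \<cdot> a \<sqsubseteq> a \<cdot> b" using that(1) by (intro below_mult) auto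
    then have "jle a (a \<cdot> b)"
      using jle_square [OF that(1)] by (blast intro: jle_trans below_imp_jle)
    moreover have "jle (a \<cdot> b) a" using that by (intro rle_imp_jle rle_mult)
    ultimately show ?thesis by (simp add: green_J_iff)
  qed
  ultimately show ?thesis
    by (auto simp: complete_semilattice_congruence_def semilattice_congruence_def os_congruence_def)
qed

text \<open>Again through the square: \<open>a\<close> is \<J>-below \<open>aa\<close>, and
  multiplying \<open>jle a b\<close> by \<open>a\<close> leads on to \<open>ab\<close>. In
  particular \<J>-classes are closed under multiplication.\<close>

lemma green_J_mult_left:
  assumes "(a, b) \<in> green_J S" shows "(a, a \<cdot> b) \<in> green_J S"
proof -
  have C: "a \<in> carrier S" "b \<in> carrier S" and "jle a b"
    using assms by (auto simp: green_J_iff jle_def)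
  have "jle a (a \<cdot> b)"
    using jle_square [OF C(1)] jle_mult(1) [OF \<open>jle a b\<close> C(1)] by (rule jle_trans)
  then show ?thesis using C by (auto simp: green_J_iff intro: rle_imp_jle rle_mult)
qed

text \<open>The multipliers are \<open>s = awya\<close> with \<open>a \<le> awa\<close>, \<open>a \<le> yab\<close>, and dually.\<close>

lemma green_J_class_group_like:
  assumes J: "(a, b) \<in> green_J S"
  shows "\<exists>s. (a, s) \<in> green_J S \<and> a \<sqsubseteq> s \<cdot> b" "\<exists>s. (a, s) \<in> green_J S \<and> a \<sqsubseteq> b \<cdot> s"
proof -
  have C: "a \<in> carrier S" "b \<in> carrier S"
    using assms by (auto simp: green_J_iff jle_def)
  obtain w where w: "w \<in> carrier S" "a \<sqsubseteq> a \<cdot> w \<cdot> a" using ex_inverse [OF C(1)] by blast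
  have ab: "jle a (a \<cdot> b)" using green_J_mult_left [OF J] by (simp add: green_J_iff)
  have ba: "jle a (b \<cdot> a)" using jle_trans [OF ab jle_mult_swap] C by simp
  obtain y where y: "y \<in> carrier S" "a \<sqsubseteq> y \<cdot> (a \<cdot> b)" using jle_imp [OF ab] by (auto simp: lle_def)
  obtain z where z: "z \<in> carrier S" "a \<sqsubseteq> b \<cdot> a \<cdot> z" using jle_imp [OF ba] by (auto simp: rle_def)
  define s where "s = a \<cdot> w \<cdot> y \<cdot> a"
  define t where "t = a \<cdot> z \<cdot> w \<cdot> a"
  have st: "s \<in> carrier S" "t \<in> carrier S" using C w y z by (simp_all add: s_def t_def)
  have sb: "a \<sqsubseteq> s \<cdot> b"
    using below_trans [OF w(2) below_mult [OF below_refl y(2)]] C w y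
    by (simp add: s_def mult_assoc)
  have "a \<sqsubseteq> a \<cdot> (w \<cdot> a)" using C w by (simp add: mult_assoc)
  also have "\<dots> \<sqsubseteq> b \<cdot> a \<cdot> z \<cdot> (w \<cdot> a)" using C w by (intro below_mult [OF z(2)]) auto
  finally have bt: "a \<sqsubseteq> b \<cdot> t" using C w z by (simp add: t_def mult_assoc)
  \<comment> \<open>The multipliers stay in the class of \<open>a\<close>: the bounds
    \<open>a \<le> sb\<close> and \<open>a \<le> bt\<close> give one direction, the final factor
    \<open>a\<close> of \<open>s\<close> and \<open>t\<close> the other.\<close>
  have "jle a s" "jle a t"
    using rle_imp_jle [OF rleI [OF sb]] lle_imp_jle [OF lleI [OF bt]] C st by auto
  moreover have "jle s a" "jle t a"
    using C w y z by (auto simp: s_def t_def intro!: lle_imp_jle lle_mult)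
  ultimately show "\<exists>s. (a, s) \<in> green_J S \<and> a \<sqsubseteq> s \<cdot> b" "\<exists>s. (a, s) \<in> green_J S \<and> a \<sqsubseteq> b \<cdot> s"
    using sb bt by (auto simp: green_J_iff)
qed

lemma complete_semilattice_of_group_likes_if_jle_imp: "complete_semilattice_of_group_likes S"
proof -
  note cong = complete_semilattice_congruence_green_J
  have "group_like_ordered_semigroup (S\<lparr>carrier := T\<rparr>)" if "T \<in> carrier S // green_J S" for T
  proof -
    obtain t where t: "t \<in> carrier S" "T = green_J S `` {t}"
      using \<open>T \<in> carrier S // green_J S\<close> by (rule quotientE)
    have T: "T \<subseteq> carrier S" by (auto simp: t green_J_def)
    have J: "(a, b) \<in> green_J S" if "a \<in> T" "b \<in> T" for a b
      using that by (auto simp: t green_J_def)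
    have in_T: "b \<in> T" if "a \<in> T" "(a, b) \<in> green_J S" for a b
      using that by (auto simp: t green_J_def)
    have closed: "a \<cdot> b \<in> T" if "a \<in> T" "b \<in> T" for a b
      using in_T [OF that(1) green_J_mult_left [OF J [OF that]]] .
    \<comment> \<open>Regularity of \<open>S\<close> does not place its multiplier in
      \<open>T\<close>. Instead two divisions within the class are combined:
      \<open>a \<le> ar\<close> and \<open>r \<le> ua\<close>, so
      \<open>a \<le> aua\<close>.\<close>
    have regT: "\<exists>s\<in>T. a \<sqsubseteq> a \<cdot> s \<cdot> a" if a: "a \<in> T" for a
    proof -
      obtain r where r: "(a, r) \<in> green_J S" "a \<sqsubseteq> a \<cdot> r"
        using green_J_class_group_like(2) [OF J [OF a a]] by blast
      obtain u where u: "(r, u) \<in> green_J S" "r \<sqsubseteq> u \<cdot> a"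
        using green_J_class_group_like(1) [OF J [OF in_T [OF a r(1)] a]] by blast
      have "u \<in> T" using in_T [OF in_T [OF a r(1)] u(1)] .
      moreover have "a \<sqsubseteq> a \<cdot> u \<cdot> a"
        using below_trans [OF r(2) below_mult [OF below_refl u(2)]] a T \<open>u \<in> T\<close>
        by (simp add: mult_assoc subset_iff)
      ultimately show ?thesis by blast
    qed
    show ?thesis
    proof
      show "reflp_on (carrier (S\<lparr>carrier := T\<rparr>)) (\<preceq>\<^bsub>S\<lparr>carrier := T\<rparr>\<^esub>)"
        using le_refl T by (auto intro: reflp_on_subset)
      show "transp_on (carrier (S\<lparr>carrier := T\<rparr>)) (\<preceq>\<^bsub>S\<lparr>carrier := T\<rparr>\<^esub>)"
        using le_trans T by (auto intro: transp_on_subset)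
      show "antisymp_on (carrier (S\<lparr>carrier := T\<rparr>)) (\<preceq>\<^bsub>S\<lparr>carrier := T\<rparr>\<^esub>)"
        using le_antisym T by (auto intro: antisymp_on_subset)
    next
      fix a assume "a \<in> carrier (S\<lparr>carrier := T\<rparr>)"
      then show "a \<in> down (S\<lparr>carrier := T\<rparr>)
          {a \<cdot>\<^bsub>S\<lparr>carrier := T\<rparr>\<^esub> s \<cdot>\<^bsub>S\<lparr>carrier := T\<rparr>\<^esub> a |s. s \<in> carrier (S\<lparr>carrier := T\<rparr>)}"
        using regT [of a] by (auto simp: down_def below_def)
    next
      fix a b assume ab: "a \<in> carrier (S\<lparr>carrier := T\<rparr>)" "b \<in> carrier (S\<lparr>carrier := T\<rparr>)"
      then have ab': "a \<in> T" "b \<in> T" by auto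
      show "a \<in> down (S\<lparr>carrier := T\<rparr>)
          {s \<cdot>\<^bsub>S\<lparr>carrier := T\<rparr>\<^esub> b |s. s \<in> carrier (S\<lparr>carrier := T\<rparr>)}"
        using green_J_class_group_like(1) [OF J [OF ab']] in_T [OF ab'(1)] ab'
        by (auto simp: down_def below_def)
      show "b \<in> down (S\<lparr>carrier := T\<rparr>)
          {a \<cdot>\<^bsub>S\<lparr>carrier := T\<rparr>\<^esub> s |s. s \<in> carrier (S\<lparr>carrier := T\<rparr>)}"
        using green_J_class_group_like(2) [OF J [OF ab'(2,1)]] in_T [OF ab'(2)] ab'
        by (auto simp: down_def below_def)
    qed (use T closed in \<open>auto simp: mult_assoc mult_left_mono mult_right_mono subset_iff\<close>)
  qed
  then show ?thesis using cong by (auto simp: complete_semilattice_of_group_likes_def)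
qed

end

end

section \<open>The implications between the six conditions\<close>

theorem theorem3p8:
  fixes S :: "('a, 'm) osgrp_scheme" (structure)
  assumes "regular_ordered_semigroup S"
  defines "c1 \<equiv> inverse_ordered_semigroup S \<and> completely_regular_ordered_semigroup S"
    and "c2 \<equiv> complete_semilattice_of_group_likes S"
    and "c3 \<equiv> \<forall>a\<in>carrier S. \<forall>b\<in>carrier S.
      a \<cdot> b \<in> ordered_idempotents S \<and> b \<cdot> a \<in> ordered_idempotents S \<longrightarrow>
      (a \<cdot> b, b \<cdot> a) \<in> green_H S"
    and "c4 \<equiv> \<forall>e\<in>ordered_idempotents S. \<forall>a\<in>carrier S. H_commutative S e a"
    and "c5 \<equiv> \<forall>e\<in>ordered_idempotents S. \<forall>f\<in>ordered_idempotents S.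
      (e, f) \<in> green_J S \<longrightarrow> (e, f) \<in> green_H S"
    and "c6 \<equiv> green_H S = green_L S \<and> green_L S = green_R S \<and> green_R S = green_J S"
  shows "(c1 \<longleftrightarrow> c2) \<and> (c2 \<longleftrightarrow> c3) \<and> (c3 \<longleftrightarrow> c4) \<and> (c4 \<longleftrightarrow> c5) \<and> (c5 \<longleftrightarrow> c6)"
proof -
  interpret regular_ordered_semigroup S by fact
  \<comment> \<open>\<open>P\<close>, the collapse of the preorders, is the hub. The conditions
    \<open>c1\<close>, \<open>c2\<close> and \<open>c5\<close> each lead to \<open>c3\<close>, then
    \<open>c3\<close> to \<open>c4\<close> and \<open>c4\<close> to \<open>P\<close>; from
    \<open>P\<close> follow \<open>c1\<close>, \<open>c2\<close> and \<open>c6\<close>, and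
    \<open>c6\<close> gives \<open>c5\<close>.\<close>
  define P where "P \<longleftrightarrow> (\<forall>a b. jle a b \<longrightarrow> lle a b \<and> rle a b)"
  have "c1 \<Longrightarrow> c3"
    unfolding c1_def c3_def using inverse_completely_regular_imp_rotations by blast
  moreover have "c2 \<Longrightarrow> c3"
    unfolding c2_def c3_def using semilattice_of_group_likes_imp_rotations by blast
  moreover have "c3 \<Longrightarrow> c4"
    unfolding c3_def c4_def using H_commutative_if_rotations
    by (auto simp: ordered_idempotents_def)
  moreover have "c4 \<Longrightarrow> P"
    unfolding c4_def P_def using jle_imp_lle_rle_if_H_commutative by blast
  moreover have "P \<Longrightarrow> c1"
    unfolding c1_def P_def
    using inverse_if_jle_imp completely_regular_if_jle_imp by blast
  moreover have "P \<Longrightarrow> c2"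
    unfolding c2_def P_def using complete_semilattice_of_group_likes_if_jle_imp by blast
  moreover have "P \<Longrightarrow> c6"
    unfolding c6_def P_def using green_relations_coincide by blast
  moreover have "c6 \<Longrightarrow> c5"
    unfolding c5_def c6_def by blast
  moreover have "c5 \<Longrightarrow> c3"
    unfolding c3_def c5_def using green_J_mult_swap by blast
  ultimately show ?thesis by blast
qed

end
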